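(* Let $\{x_n,y_n\}_{n=-1}^{\infty}$ be a solution of the system of difference equations $$x_{n+1}=\frac{-1}{y_n(x_{n-1}-1)+1},\qquad y_{n+1}=\frac{-1}{x_n(y_{n-1}-1)+1},\qquad n=0,1,2,\dots,$$ with real initial conditions satisfying $(x_{-1},y_{-1},x_0,y_0)\in\mathbb{R}^4\setminus F$, where $$F=\bigcup_{n=-1}^{\infty}\left\{(x_{-1},y_{-1},x_0,y_0)\in\mathbb{R}^4: A_n=0\ \text{or}\ B_n=0\ \text{or}\ C_n=0\ \text{or}\ D_n=0\right\}$$ and $$A_n=T_{2n-1}x_{-1}y_0-(T_{2n-2}+T_{2n-1})y_0+T_{2n},$$ $$B_n=T_{2n}y_{-1}x_0-(T_{2n-1}+T_{2n})x_0+T_{2n+1},$$ $$C_n=T_{2n-1}y_{-1}x_0-(T_{2n-2}+T_{2n-1})x_0+T_{2n},$$ $$D_n=T_{2n}x_{-1}y_0-(T_{2n-1}+T_{2n})y_0+T_{2n+1}.$$ Here $T_n$ is the $n$th Tribonacci number. Then, for all $n=0,1,2,\dots$, $$x_{2n-1}=\frac{-\left(T_{2n-2}x_{-1}y_0+(T_{2n-1}-T_{2n})y_0+T_{2n-1}\right)}{T_{2n-1}x_{-1}y_0-(T_{2n-2}+T_{2n-1})y_0+T_{2n}},$$ $$x_{2n}=\frac{-\left(T_{2n-1}y_{-1}x_0+(T_{2n}-T_{2n+1})x_0+T_{2n}\right)}{T_{2n}y_{-1}x_0-(T_{2n-1}+T_{2n})x_0+T_{2n+1}},$$ $$y_{2n-1}=\frac{-\left(T_{2n-2}y_{-1}x_0+(T_{2n-1}-T_{2n})x_0+T_{2n-1}\right)}{T_{2n-1}y_{-1}x_0-(T_{2n-2}+T_{2n-1})x_0+T_{2n}},$$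 $$y_{2n}=\frac{-\left(T_{2n-1}x_{-1}y_0+(T_{2n}-T_{2n+1})y_0+T_{2n}\right)}{T_{2n}x_{-1}y_0-(T_{2n-1}+T_{2n})y_0+T_{2n+1}}.$$
   Context: The Tribonacci numbers $(T_n)_{n\in\mathbb{Z}}$ are defined by $T_0=0$, $T_1=1$, $T_2=1$ and $T_{n+3}=T_{n+2}+T_{n+1}+T_n$, extended to negative indices by the same recurrence, i.e. $T_{-n}=T_{-n+3}-T_{-n+2}-T_{-n+1}$ for $n\ge 1$ (so $T_{-1}=0$, $T_{-2}=1$, $T_{-3}=-1$, $T_{-4}=0$). *)

theory Defs
  imports Complex_Main
begin

function trib :: "int \<Rightarrow> int" where
  "trib n =
    (if n < 0 then trib (n + 3) - trib (n + 2) - trib (n + 1)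
     else if n = 0 then 0
     else if n = 1 then 1
     else if n = 2 then 1
     else trib (n - 1) + trib (n - 2) + trib (n - 3))"
  by pat_completeness auto
termination
  by (relation "measure (\<lambda>n. if n < 0 then nat (3 - n) else nat n)") auto

declare trib.simps [simp del]

lemma trib_initial: "trib 0 = 0" "trib 1 = 1" "trib 2 = 1"
  by (simp_all add: trib.simps)

lemma trib_rec: "trib (n + 3) = trib (n + 2) + trib (n + 1) + trib n"
  using trib.simps [of n] trib.simps [of "n + 3"] by (cases "n < 0") (auto simp: algebra_simps)

lemma trib_negative: "trib (-1) = 0" "trib (-2) = 1" "trib (-3) = -1" "trib (-4) = 0"
  by (simp_all add: trib.simps)

abbreviation T :: "int \<Rightarrow> real" where
  "T n \<equiv> real_of_int (trib n)"

text \<open>In the following the arguments \<open>x' y' x0 y0\<close> stand for the initial values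
  $x_{-1}, y_{-1}, x_0, y_0$, in this order.\<close>

definition A :: "int \<Rightarrow> real \<Rightarrow> real \<Rightarrow> real \<Rightarrow> real \<Rightarrow> real" where
  "A n x' y' x0 y0 = T (2*n - 1) * x' * y0 - (T (2*n - 2) + T (2*n - 1)) * y0 + T (2*n)"

definition B :: "int \<Rightarrow> real \<Rightarrow> real \<Rightarrow> real \<Rightarrow> real \<Rightarrow> real" where
  "B n x' y' x0 y0 = T (2*n) * y' * x0 - (T (2*n - 1) + T (2*n)) * x0 + T (2*n + 1)"

definition C :: "int \<Rightarrow> real \<Rightarrow> real \<Rightarrow> real \<Rightarrow> real \<Rightarrow> real" where
  "C n x' y' x0 y0 = T (2*n - 1) * y' * x0 - (T (2*n - 2) + T (2*n - 1)) * x0 + T (2*n)"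

definition D :: "int \<Rightarrow> real \<Rightarrow> real \<Rightarrow> real \<Rightarrow> real \<Rightarrow> real" where
  "D n x' y' x0 y0 = T (2*n) * x' * y0 - (T (2*n - 1) + T (2*n)) * y0 + T (2*n + 1)"

definition F :: "(real \<times> real \<times> real \<times> real) set" where
  "F = (\<Union>n\<in>{-1..}. {(x', y', x0, y0).
          A n x' y' x0 y0 = 0 \<or> B n x' y' x0 y0 = 0 \<or>
          C n x' y' x0 y0 = 0 \<or> D n x' y' x0 y0 = 0})"

text \<open>Sequences indexed by $n \ge -1$ are functions on \<^typ>\<open>int\<close>; values at indices
  below $-1$ are unconstrained. Division is total (\<^term>\<open>a / 0 = (0::real)\<close>), so the equations
  do not by themselves require nonzero denominators. No such condition is added: outside
  \<^term>\<open>F\<close> the denominators are nonzero automatically.\<close>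

definition is_solution :: "(int \<Rightarrow> real) \<Rightarrow> (int \<Rightarrow> real) \<Rightarrow> bool" where
  "is_solution x y \<longleftrightarrow> (\<forall>n\<ge>0.
     x (n + 1) = -1 / (y n * (x (n - 1) - 1) + 1) \<and>
     y (n + 1) = -1 / (x n * (y (n - 1) - 1) + 1))"

end

theory Submission
  imports Defs
begin

text \<open>The system decouples into the two interlaced sequences
  $x_{-1}, y_0, x_1, y_2, \dots$ and $y_{-1}, x_0, y_1, x_2, \dots$, each of which satisfies the scalar
  recurrence $u_{n+1} = -1/(u_n(u_{n-1}-1)+1)$. Substituting $u_n = -P_{n-1}/P_n$ turns this into the
  Tribonacci recurrence $P_{n+1} = P_n + P_{n-1} + P_{n-2}$, whose solution with the given initial
  values is a combination of shifted Tribonacci numbers.\<close>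

text \<open>This is the Tribonacci-type sequence taking the values \<open>a * b\<close>,
  \<open>- b\<close>, \<open>1\<close> at the indices -2, -1, 0. The quotients of neighbours then
  start from \<open>a\<close> at -1 (if \<open>b\<close> is nonzero) and \<open>b\<close> at 0, up
  to sign.\<close>

definition trib_comb :: "real \<Rightarrow> real \<Rightarrow> int \<Rightarrow> real" where
  "trib_comb a b k = T k * a * b - (T (k - 1) + T k) * b + T (k + 1)"

lemma T_rec: "T k = T (k - 1) + T (k - 2) + T (k - 3)"
  using trib_rec [of "k - 3"] by simp

lemma trib_comb_rec:
  "trib_comb a b (k + 1) = trib_comb a b k + trib_comb a b (k - 1) + trib_comb a b (k - 2)"
  using T_rec [of k] T_rec [of "k + 1"] T_rec [of "k + 2"]
  by (simp add: trib_comb_def algebra_simps)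

text \<open>Rewriting \<open>T (k - 2) + T (k - 1)\<close> as \<open>T (k + 1) - T k\<close> brings
  a term into the shape of the numerators in the closed formulas.\<close>

lemma trib_comb_pred:
  "trib_comb a b (k - 1) = T (k - 1) * a * b + (T k - T (k + 1)) * b + T k"
  using T_rec [of "k + 1"] by (simp add: trib_comb_def algebra_simps)

lemma scalar_solution:
  fixes u :: "int \<Rightarrow> real"
  defines "P \<equiv> trib_comb (u (-1)) (u 0)"
  assumes rec: "\<And>n. n \<ge> 0 \<Longrightarrow> u (n + 1) = -1 / (u n * (u (n - 1) - 1) + 1)"
    and nz: "\<And>k. k \<ge> -1 \<Longrightarrow> P k \<noteq> 0"
    and "k \<ge> -1"
  shows "u k = - P (k - 1) / P k"
proof -
  \<comment> \<open>The recurrence has order two, so the induction carries two consecutive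
    values.\<close>
  have pair: "u (n - 1) = - P (n - 2) / P (n - 1) \<and> u n = - P (n - 1) / P n" if "n \<ge> 0" for n
    using that
  proof (induction n rule: int_ge_induct)
    case base
    then show ?case
      \<comment> \<open>Since \<open>P (-1) = - u 0\<close>, nonvanishing at -1 says that
        \<open>u 0\<close> is nonzero, so it cancels in \<open>- P (-2) / P (-1)\<close>.\<close>
      using nz [of "-1"] by (simp add: P_def trib_comb_def trib_initial trib_negative)
  next
    case (step n)
    have nz': "P (n - 1) \<noteq> 0" "P n \<noteq> 0" "P (n + 1) \<noteq> 0"
      using step.hyps by (simp_all add: nz)
    \<comment> \<open>Here \<open>u (n - 1) - 1 = - (P (n - 2) + P (n - 1)) / P (n - 1)\<close>, and
      its denominator cancels against the numerator of \<open>u n\<close>.\<close>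
    have "u n * (u (n - 1) - 1) + 1 = (P n + P (n - 1) + P (n - 2)) / P n"
      unfolding step.IH [THEN conjunct1] step.IH [THEN conjunct2]
      using nz' by (simp add: field_simps)
    also have "\<dots> = P (n + 1) / P n"
      by (simp add: P_def trib_comb_rec)
    finally show ?case
      using rec [OF step.hyps] step.IH by simp
  qed
  show ?thesis
    using pair [of "k + 1"] \<open>k \<ge> -1\<close> by simp
qed

lemma interlaced_solution:
  fixes x y :: "int \<Rightarrow> real"
  defines "P \<equiv> trib_comb (x (-1)) (y 0)"
  assumes sol: "is_solution x y"
    and odd_nz: "\<And>n. n \<ge> 0 \<Longrightarrow> P (2*n - 1) \<noteq> 0"
    and even_nz: "\<And>n. n \<ge> 0 \<Longrightarrow> P (2*n) \<noteq> 0"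
    and "n \<ge> 0"
  shows "x (2*n - 1) = - P (2*n - 1 - 1) / P (2*n - 1)"
    and "y (2*n) = - P (2*n - 1) / P (2*n)"
proof -
  \<comment> \<open>Each equation of the system links an index of one parity in one sequence to the
    opposite parity in the other, so choosing by parity yields a single scalar sequence.\<close>
  define u where "u k = (if even k then y k else x k)" for k
  have P: "P = trib_comb (u (-1)) (u 0)"
    by (simp add: P_def u_def)
  have rec: "u (m + 1) = -1 / (u m * (u (m - 1) - 1) + 1)" if "m \<ge> 0" for m
    using sol that by (simp add: is_solution_def u_def)
  have nz: "P k \<noteq> 0" if "k \<ge> -1" for k
  proof (cases "even k")
    case True
    then obtain m where "k = 2 * m" by blast
    with that show ?thesis using even_nz [of m] by simp
  next
    case False
    then obtain m where "k = 2 * m + 1" by (elim oddE)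
    \<comment> \<open>The shift to \<open>m + 1\<close> writes \<open>k\<close> as
      \<open>2 * (m + 1) - 1\<close>; the smallest case \<open>k = -1\<close> corresponds to index 0
      of \<open>odd_nz\<close>.\<close>
    with that show ?thesis using odd_nz [of "m + 1"] by (simp add: add.commute)
  qed
  have u: "u k = - P (k - 1) / P k" if "k \<ge> -1" for k
    unfolding P using rec nz that by (intro scalar_solution) (simp_all add: P)
  show "x (2*n - 1) = - P (2*n - 1 - 1) / P (2*n - 1)" "y (2*n) = - P (2*n - 1) / P (2*n)"
    using u [of "2*n - 1"] u [of "2*n"] \<open>n \<ge> 0\<close> by (simp_all add: u_def)
qed

lemma is_solution_swap: "is_solution x y \<Longrightarrow> is_solution y x"
  by (simp add: is_solution_def)

theorem theorem8:
  fixes x y :: "int \<Rightarrow> real"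
  assumes "is_solution x y"
    and "(x (-1), y (-1), x 0, y 0) \<notin> F"
  shows "\<forall>n\<ge>0.
    x (2*n - 1) =
      - (T (2*n - 2) * x (-1) * y 0 + (T (2*n - 1) - T (2*n)) * y 0 + T (2*n - 1)) /
        (T (2*n - 1) * x (-1) * y 0 - (T (2*n - 2) + T (2*n - 1)) * y 0 + T (2*n)) \<and>
    x (2*n) =
      - (T (2*n - 1) * y (-1) * x 0 + (T (2*n) - T (2*n + 1)) * x 0 + T (2*n)) /
        (T (2*n) * y (-1) * x 0 - (T (2*n - 1) + T (2*n)) * x 0 + T (2*n + 1)) \<and>
    y (2*n - 1) =
      - (T (2*n - 2) * y (-1) * x 0 + (T (2*n - 1) - T (2*n)) * x 0 + T (2*n - 1)) /
        (T (2*n - 1) * y (-1) * x 0 - (T (2*n - 2) + T (2*n - 1)) * x 0 + T (2*n)) \<and>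
    y (2*n) =
      - (T (2*n - 1) * x (-1) * y 0 + (T (2*n) - T (2*n + 1)) * y 0 + T (2*n)) /
        (T (2*n) * x (-1) * y 0 - (T (2*n - 1) + T (2*n)) * y 0 + T (2*n + 1))"
proof (intro allI impI)
  fix n :: int
  assume "n \<ge> 0"
  let ?P = "trib_comb (x (-1)) (y 0)"
  let ?Q = "trib_comb (y (-1)) (x 0)"
  have nz: "?P (2*m - 1) \<noteq> 0" "?P (2*m) \<noteq> 0" "?Q (2*m - 1) \<noteq> 0" "?Q (2*m) \<noteq> 0" if "m \<ge> 0" for m
  proof -
    \<comment> \<open>\<open>A\<close> and \<open>D\<close> are the odd- and even-indexed terms of
      \<open>?P\<close>; \<open>C\<close> and \<open>B\<close> are those of
      \<open>?Q\<close>.\<close>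
    have "A m (x (-1)) (y (-1)) (x 0) (y 0) \<noteq> 0 \<and> B m (x (-1)) (y (-1)) (x 0) (y 0) \<noteq> 0 \<and>
        C m (x (-1)) (y (-1)) (x 0) (y 0) \<noteq> 0 \<and> D m (x (-1)) (y (-1)) (x 0) (y 0) \<noteq> 0"
      using assms(2) that by (force simp: F_def)
    then show "?P (2*m - 1) \<noteq> 0" "?P (2*m) \<noteq> 0" "?Q (2*m - 1) \<noteq> 0" "?Q (2*m) \<noteq> 0"
      by (simp_all add: A_def B_def C_def D_def trib_comb_def)
  qed
  note xy = interlaced_solution [OF assms(1) nz(1,2) \<open>n \<ge> 0\<close>]
  \<comment> \<open>Exchanging \<open>x\<close> and \<open>y\<close> preserves the system, which
    settles the other interlaced sequence: \<open>y\<close> at odd and \<open>x\<close> at even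
    indices.\<close>
  note yx = interlaced_solution [OF is_solution_swap [OF assms(1)] nz(3,4) \<open>n \<ge> 0\<close>]
  have num: "trib_comb a b (2*n - 1 - 1) =
      T (2*n - 2) * a * b + (T (2*n - 1) - T (2*n)) * b + T (2*n - 1)"
    "trib_comb a b (2*n - 1) = T (2*n - 1) * a * b + (T (2*n) - T (2*n + 1)) * b + T (2*n)" for a b
    using trib_comb_pred [of a b "2*n - 1"] trib_comb_pred [of a b "2*n"] by simp_all
  have den: "trib_comb a b (2*n - 1) =
      T (2*n - 1) * a * b - (T (2*n - 2) + T (2*n - 1)) * b + T (2*n)"
    "trib_comb a b (2*n) = T (2*n) * a * b - (T (2*n - 1) + T (2*n)) * b + T (2*n + 1)" for a b
    by (simp_all add: trib_comb_def)
  show "x (2*n - 1) =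
      - (T (2*n - 2) * x (-1) * y 0 + (T (2*n - 1) - T (2*n)) * y 0 + T (2*n - 1)) /
        (T (2*n - 1) * x (-1) * y 0 - (T (2*n - 2) + T (2*n - 1)) * y 0 + T (2*n)) \<and>
    x (2*n) =
      - (T (2*n - 1) * y (-1) * x 0 + (T (2*n) - T (2*n + 1)) * x 0 + T (2*n)) /
        (T (2*n) * y (-1) * x 0 - (T (2*n - 1) + T (2*n)) * x 0 + T (2*n + 1)) \<and>
    y (2*n - 1) =
      - (T (2*n - 2) * y (-1) * x 0 + (T (2*n - 1) - T (2*n)) * x 0 + T (2*n - 1)) /
        (T (2*n - 1) * y (-1) * x 0 - (T (2*n - 2) + T (2*n - 1)) * x 0 + T (2*n)) \<and>
    y (2*n) =
      - (T (2*n - 1) * x (-1) * y 0 + (T (2*n) - T (2*n + 1)) * y 0 + T (2*n)) /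
        (T (2*n) * x (-1) * y 0 - (T (2*n - 1) + T (2*n)) * y 0 + T (2*n + 1))"
    using xy(1) yx(2) yx(1) xy(2) unfolding num(1) den(1) [symmetric] den(2) [symmetric] num(2) [symmetric] by simp
qed

end
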